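(* Let $D$ be an oriented graph and let $p$ be an integer. If $D$ is $(=p)$-invertible, then $\mathrm{inv}^{= p}(D) \leq |A(D)|$.
   Context: For an oriented graph $D$ and $X\subseteq V(D)$, the inversion of $X$ reverses the orientation of every arc with both endpoints in $X$. A $(=p)$-inversion is the inversion of a set of exactly $p$ vertices. $D$ is $(=p)$-invertible if it can be made acyclic by a sequence of $(=p)$-inversions, and $\mathrm{inv}^{=p}(D)$ is the minimum number of $(=p)$-inversions whose successive application makes $D$ acyclic ($+\infty$ if none exists). $A(D)$ is the arc set of $D$. *)

theory Defs
  imports "Graph_Theory.Pair_Digraph" "HOL-Library.Extended_Nat"
begin

locale oriented_graph = pair_digraph D for D :: "'a pair_pre_digraph" +
  assumes no_digons: "(u, v) \<in> parcs D \<Longrightarrow> (v, u) \<notin> parcs D"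

definition acyclic_digraph :: "'a pair_pre_digraph \<Rightarrow> bool" where
  "acyclic_digraph D \<longleftrightarrow> \<not> (\<exists>c. pre_digraph.cycle (with_proj D) c)"

definition inversion :: "'a set \<Rightarrow> 'a pair_pre_digraph \<Rightarrow> 'a pair_pre_digraph" where
  "inversion X D = D\<lparr>parcs :=
     (\<lambda>(u, v). if u \<in> X \<and> v \<in> X then (v, u) else (u, v)) ` parcs D\<rparr>"

text \<open>
  The sequences of \<open>(=p)\<close>-inversions, applied from left to right, that make \<open>D\<close> acyclic.
  Inversions do not change the vertex set, so the admissible sets at every step are the
  \<open>p\<close>-subsets of the vertex set of \<open>D\<close>.
\<close>
definition eq_decycling_seqs :: "int \<Rightarrow> 'a pair_pre_digraph \<Rightarrow> 'a set list set" where
  "eq_decycling_seqs p D =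
     {Xs. (\<forall>X\<in>set Xs. X \<subseteq> pverts D \<and> int (card X) = p) \<and> acyclic_digraph (fold inversion Xs D)}"

definition eq_invertible :: "int \<Rightarrow> 'a pair_pre_digraph \<Rightarrow> bool" where
  "eq_invertible p D \<longleftrightarrow> eq_decycling_seqs p D \<noteq> {}"

text \<open>The infimum is a minimum if the index set is nonempty, and \<open>\<infinity>\<close> otherwise.\<close>
definition eq_inversion_number :: "int \<Rightarrow> 'a pair_pre_digraph \<Rightarrow> enat" where
  "eq_inversion_number p D = (INF Xs\<in>eq_decycling_seqs p D. enat (length Xs))"

end

theory Submission
  imports Defs
begin

text \<open>
  A sequence of inversions acts on \<open>D\<close> only through the vector in
  \<open>\<bbbF>\<^sub>2\<^bsup>A(D)\<^esup>\<close> recording the parity of the number of reversals of each arc.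
  If the sequence has more than \<open>|A(D)|\<close> terms, the pigeonhole principle yields two
  different subsequences with the same parity vector. The terms in their symmetric difference
  cancel out and can be dropped.
\<close>

text \<open>In linear algebra terms, a minimal subfamily with a prescribed sum in a vector space
  over the field with two elements is linearly independent. Strong induction is used because
  dropping a single cancelling subfamily need not bring the size down to
  \<open>card A\<close>.\<close>

lemma parity_card_subfamily:
  fixes P :: "'i \<Rightarrow> 'a \<Rightarrow> bool"
  assumes "finite A" "finite I"
  shows "\<exists>J\<subseteq>I. card J \<le> card A \<and>
    (\<forall>a\<in>A. odd (card {i\<in>J. P i a}) \<longleftrightarrow> odd (card {i\<in>I. P i a}))"
  using assms(2)
proof (induction I rule: finite_psubset_induct)
  case (psubset I)
  define c where "c S a = card {i\<in>S. P i a}" for S a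
  have c_Un: "c (S \<union> T) a = c S a + c T a" if "S \<subseteq> I" "T \<subseteq> I" "S \<inter> T = {}" for S T a
  proof -
    have "{i\<in>S \<union> T. P i a} = {i\<in>S. P i a} \<union> {i\<in>T. P i a}" by blast
    then show ?thesis
      using that psubset.hyps
      by (auto simp: c_def intro!: card_Un_disjoint intro: finite_subset)
  qed
  show ?case
  proof (cases "card I \<le> card A")
    case True
    then show ?thesis by blast
  next
    case False
    \<comment> \<open>The parity vector of \<open>S\<close>, encoded by its support, so that there
      are at most \<open>2 ^ card A\<close> values.\<close>
    define F where "F S = {a\<in>A. odd (c S a)}" for S
    have "card (F ` Pow I) \<le> card (Pow A)"
      using assms(1) by (intro card_mono) (auto simp: F_def)
    also have "\<dots> < card (Pow I)"
      using False assms(1) psubset.hyps by (simp add: card_Pow)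
    finally have "\<not> inj_on F (Pow I)"
      by (rule pigeonhole)
    then obtain S T where ST: "S \<subseteq> I" "T \<subseteq> I" "S \<noteq> T" "F S = F T"
      by (auto simp: inj_on_def)
    define K where "K = (S - T) \<union> (T - S)"
    have K: "K \<subseteq> I" "K \<noteq> {}"
      using ST by (auto simp: K_def)
    have even_K: "even (c K a)" if "a \<in> A" for a
    proof -
      have "c S a = c (S - T) a + c (S \<inter> T) a" if "S \<subseteq> I" for S T
      proof -
        have "(S - T) \<union> (S \<inter> T) = S" by blast
        then show ?thesis
          using c_Un[of "S - T" "S \<inter> T" a] that by force
      qed
      from this[OF ST(1), of T] this[OF ST(2), of S]
      have split: "c S a = c (S - T) a + c (S \<inter> T) a" "c T a = c (T - S) a + c (S \<inter> T) a"
        by (simp_all only: Int_commute)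
      have "odd (c S a) \<longleftrightarrow> odd (c T a)"
        using ST(4) that by (auto simp: F_def)
      \<comment> \<open>The common part \<open>S \<inter> T\<close> contributes equally to both
        counts and cancels modulo 2.\<close>
      then have "even (c (S - T) a) \<longleftrightarrow> even (c (T - S) a)"
        unfolding split even_add by (cases "even (c (S \<inter> T) a)") simp_all
      moreover have "c K a = c (S - T) a + c (T - S) a"
        unfolding K_def using ST by (intro c_Un) auto
      ultimately show ?thesis
        by (simp only: even_add)
    qed
    have "I - K \<subset> I"
      using K by blast
    from psubset.IH[OF this] obtain J where J: "J \<subseteq> I - K" "card J \<le> card A"
      "\<forall>a\<in>A. odd (c J a) \<longleftrightarrow> odd (c (I - K) a)"
      unfolding c_def by blast
    \<comment> \<open>Deleting \<open>K\<close> lowers every count by an even number, so the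
      parities for \<open>I - K\<close> are those for \<open>I\<close>.\<close>
    have "c I a = c (I - K) a + c K a" for a
      using c_Un[of "I - K" K a] K by (simp add: Un_absorb2 Int_commute)
    then show ?thesis
      using J even_K by (intro exI[of _ J]) (auto simp: c_def)
  qed
qed

text \<open>The family is indexed by positions in \<open>xs\<close>, since an entry may occur
  repeatedly and its multiplicity affects the parity.\<close>

lemma parity_filter_sublist:
  fixes P :: "'x \<Rightarrow> 'a \<Rightarrow> bool"
  assumes "finite A"
  shows "\<exists>ys. set ys \<subseteq> set xs \<and> length ys \<le> card A \<and>
    (\<forall>a\<in>A. odd (length (filter (\<lambda>x. P x a) ys)) \<longleftrightarrow> odd (length (filter (\<lambda>x. P x a) xs)))"
proof -
  obtain J where J: "J \<subseteq> {..<length xs}" "card J \<le> card A"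
    "\<forall>a\<in>A. odd (card {i\<in>J. P (xs ! i) a}) \<longleftrightarrow> odd (card {i\<in>{..<length xs}. P (xs ! i) a})"
    using parity_card_subfamily[OF assms, of "{..<length xs}" "\<lambda>i. P (xs ! i)"] by auto
  define ys where "ys = map ((!) xs) (sorted_list_of_set J)"
  have "finite J"
    using J(1) finite_subset by blast
  then have "length (filter (\<lambda>x. P x a) ys) = card {i\<in>J. P (xs ! i) a}" for a
    using distinct_card[of "filter (\<lambda>i. P (xs ! i) a) (sorted_list_of_set J)"]
    by (simp add: ys_def filter_map comp_def conj_commute)
  moreover have "set ys \<subseteq> set xs" "length ys \<le> card A"
    using J \<open>finite J\<close> by (auto simp: ys_def)
  ultimately show ?thesis
    using J(3) by (intro exI[of _ ys]) (auto simp: length_filter_conv_card)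
qed

text \<open>An inversion preserves the pair of endpoints of each arc up to order, so which later
  sets reverse an arc can be read off its original orientation. As \<open>prod.swap\<close> is an
  involution, only the parity of the number of reversals survives.\<close>

lemma fold_inversion:
  fixes D :: "'a pair_pre_digraph"
  shows "fold inversion Xs D = D\<lparr>parcs :=
    (\<lambda>a. if odd (length (filter (\<lambda>X. fst a \<in> X \<and> snd a \<in> X) Xs)) then prod.swap a else a)
      ` parcs D\<rparr>"
proof (induction Xs arbitrary: D)
  case Nil
  show ?case by simp
next
  case (Cons X Xs D)
  let ?r = "\<lambda>Xs a. if odd (length (filter (\<lambda>X. fst a \<in> X \<and> snd a \<in> X) Xs))
    then prod.swap a else a"
  let ?i = "\<lambda>(u, v). if u \<in> X \<and> v \<in> X then (v, u) else (u, v)"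
  have r: "?r Xs ` ?i ` parcs D = ?r (X # Xs) ` parcs D"
    unfolding image_image
  proof (rule image_cong)
    fix a :: "'a \<times> 'a"
    obtain u v where a: "a = (u, v)" by (cases a)
    \<comment> \<open>This symmetry lets the remaining sets \<open>Xs\<close> treat a reversed arc
      like the original one.\<close>
    have "(\<lambda>Y :: 'a set. v \<in> Y \<and> u \<in> Y) = (\<lambda>Y. u \<in> Y \<and> v \<in> Y)" by auto
    then show "?r Xs (?i a) = ?r (X # Xs) a"
      by (simp add: a)
  qed simp
  have "fold inversion (X # Xs) D = (inversion X D)\<lparr>parcs := ?r Xs ` parcs (inversion X D)\<rparr>"
    by (simp only: fold_simps Cons.IH)
  also have "\<dots> = D\<lparr>parcs := ?r Xs ` ?i ` parcs D\<rparr>"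
    by (cases D) (simp only: inversion_def pair_pre_digraph.simps
        pair_pre_digraph.select_convs pair_pre_digraph.update_convs)
  also have "\<dots> = D\<lparr>parcs := ?r (X # Xs) ` parcs D\<rparr>"
    unfolding r ..
  finally show ?case .
qed

theorem theorem1p6:
  fixes D :: "'a pair_pre_digraph" and p :: int
  assumes "oriented_graph D"
    and "eq_invertible p D"
  shows "eq_inversion_number p D \<le> enat (card (parcs D))"
proof -
  interpret oriented_graph D by fact
  obtain Xs where Xs: "Xs \<in> eq_decycling_seqs p D"
    using assms(2) by (auto simp: eq_invertible_def)
  obtain Ys where Ys: "set Ys \<subseteq> set Xs" "length Ys \<le> card (parcs D)"
    "\<forall>a\<in>parcs D. odd (length (filter (\<lambda>X. fst a \<in> X \<and> snd a \<in> X) Ys)) \<longleftrightarrow>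
      odd (length (filter (\<lambda>X. fst a \<in> X \<and> snd a \<in> X) Xs))"
    using parity_filter_sublist[OF pair_finite_arcs, of Xs "\<lambda>X a. fst a \<in> X \<and> snd a \<in> X"]
    by blast
  have "fold inversion Ys D = fold inversion Xs D"
    unfolding fold_inversion using Ys(3)
    by (intro arg_cong[where f = "\<lambda>E. D\<lparr>parcs := E\<rparr>"] image_cong) auto
  \<comment> \<open>The terms of \<open>Ys\<close> come from \<open>Xs\<close>, so they are still
    vertex sets of size \<open>p\<close>.\<close>
  then have "Ys \<in> eq_decycling_seqs p D"
    using Xs Ys(1) by (auto simp: eq_decycling_seqs_def)
  then have "eq_inversion_number p D \<le> enat (length Ys)"
    unfolding eq_inversion_number_def by (rule INF_lower)
  also have "\<dots> \<le> enat (card (parcs D))"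
    using Ys(2) by simp
  finally show ?thesis .
qed

end
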